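(* Let $(N, C_1, C_2, \dots)$ be a nonnegative random vector, where $N \in \{0,1,2,\dots\} \cup \{\infty\}$, and consider the weighted branching tree it defines, with $n$th generation $A_n$ and node weights $\Pi_{\mathbf i}$ (see context). For any $n$ and $\mathbf{i} \in A_n$, let $V_{\mathbf{i}} = \log \Pi_{\mathbf i}$. For $\alpha > 0$ define the measure $$\mu_n(dt) = e^{\alpha t} E\left[ \sum_{\mathbf{i} \in A_n} 1(V_{\mathbf{i}} \in dt ) \right], \quad n = 1, 2, \dots,$$ and let $\eta(dt) = \mu_1(dt)$. Suppose that there exists $j \geq 1$ with $P(N\ge j,\,C_j>0)>0$ such that the measure $P(\log C_j\in du,\, C_j > 0,\, N\ge j)$ is nonarithmetic, $0 < E\left[ \sum_{i=1}^N C_i^\alpha \log C_i \right] < \infty$ and $E\left[ \sum_{i=1}^N C_i^\alpha \right] = 1$. Then $\eta(\cdot)$ is a nonarithmetic probability measure on $\mathbb{R}$ that places no mass at $-\infty$ and has mean $$\int_{-\infty}^\infty u\, \eta(du) = E\left[ \sum_{j=1}^N C_j^\alpha \log C_j \right] .$$ Furthermore, $\mu_n(dt) = \eta^{*n}(dt)$, where $\eta^{*n}$ denotes the $n$th convolution of $\eta$ with itself.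
   Context: Weighted branching tree. Let $U=\bigcup_{k=0}^\infty \{1,2,3,\dots\}^k$, with $\{1,2,\dots\}^0=\{\emptyset\}$; $(\mathbf{i},j)$ denotes concatenation, $(\emptyset,j)=j$. Let $\{(N_{\mathbf i}, C_{(\mathbf i,1)}, C_{(\mathbf i,2)},\dots)\}_{\mathbf i\in U}$ be iid copies of $(N,C_1,C_2,\dots)$, the copy at the root $\emptyset$ being $(N,C_1,C_2,\dots)$ itself. Put $A_0=\{\emptyset\}$ and $A_n=\{(i_1,\dots,i_n)\in U: (i_1,\dots,i_{n-1})\in A_{n-1},\ 1\le i_n\le N_{(i_1,\dots,i_{n-1})}\}$ for $n\ge1$. The weights are $\Pi_\emptyset=1$ and $\Pi_{(i_1,\dots,i_n)}=C_{(i_1,\dots,i_n)}\Pi_{(i_1,\dots,i_{n-1})}$. $1(\cdot)$ is the indicator function. Conventions: $0^\alpha\log 0=0$ for $\alpha>0$; $\log 0=-\infty$ and $e^{-\infty}=0$. A measure on $\mathbb{R}$ is nonarithmetic if it is not concentrated on $d\mathbb{Z}$ for any $d>0$.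
   Formalization: Finiteness of E[∑ C_i^α log C_i] is taken as absolute, E[∑ |C_i^α log C_i|] < ∞; if only the expectation of the summed variable is finite, positive and negative parts can cancel and the mean of η need not exist. *)

theory Defs
  imports "HOL-Probability.Probability"
begin

text \<open>
  Nodes are lists of positive naturals, the root is the empty list and \<open>i @ [j]\<close> is the
  \<open>j\<close>-th child of \<open>i\<close>. The node set is \<open>lists {1..}\<close>.
\<close>

definition children :: "enat \<Rightarrow> nat set" where
  "children n = {j. 1 \<le> j \<and> enat j \<le> n}"

text \<open>
  \<open>generation\<close> and \<open>weight\<close> are deterministic functions of one realization of the
  offspring numbers and of the edge weights.
\<close>

primrec generation :: "(nat list \<Rightarrow> enat) \<Rightarrow> nat \<Rightarrow> nat list set" where
  "generation N 0 = {[]}"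
| "generation N (Suc n) = {i @ [j] | i j. i \<in> generation N n \<and> j \<in> children (N i)}"

function weight :: "(nat list \<Rightarrow> real) \<Rightarrow> nat list \<Rightarrow> real" where
  "weight C [] = 1"
| "weight C (i @ [j]) = C (i @ [j]) * weight C i"
  by (metis rev_exhaust surj_pair) auto
termination by (relation "Wellfounded.measure (length \<circ> snd)") auto

definition log_ereal :: "real \<Rightarrow> ereal" where
  "log_ereal x = (if x = 0 then -\<infinity> else ereal (ln x))"

definition exp_ereal :: "ereal \<Rightarrow> ennreal" where
  "exp_ereal t =
     (if t = -\<infinity> then 0 else if t = \<infinity> then \<infinity> else ennreal (exp (real_of_ereal t)))"

definition node_space :: "(enat \<times> (nat \<Rightarrow> real)) measure" where
  "node_space = count_space UNIV \<Otimes>\<^sub>M (\<Pi>\<^sub>M j\<in>{1..}. borel)"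

definition node_vector ::
  "(nat list \<Rightarrow> 'w \<Rightarrow> enat) \<Rightarrow> (nat list \<Rightarrow> 'w \<Rightarrow> real) \<Rightarrow> nat list \<Rightarrow> 'w \<Rightarrow> enat \<times> (nat \<Rightarrow> real)" where
  "node_vector N C i = (\<lambda>\<omega>. (N i \<omega>, \<lambda>j\<in>{1..}. C (i @ [j]) \<omega>))"

text \<open>
  The generic vector is the one at the root: its components are \<open>N []\<close> and \<open>C [j]\<close> for
  \<open>j \<ge> 1\<close>. The value \<open>C []\<close> is irrelevant.
\<close>

locale weighted_branching_tree = prob_space M
  for M :: "'w measure" +
  fixes N :: "nat list \<Rightarrow> 'w \<Rightarrow> enat" and C :: "nat list \<Rightarrow> 'w \<Rightarrow> real"
  assumes nonneg: "\<And>i j \<omega>. i \<in> lists {1..} \<Longrightarrow> 1 \<le> j \<Longrightarrow> \<omega> \<in> space M \<Longrightarrow> 0 \<le> C (i @ [j]) \<omega>"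
    and indep: "indep_vars (\<lambda>_. node_space) (node_vector N C) (lists {1..})"
    and ident_distr: "\<And>i. i \<in> lists {1..} \<Longrightarrow>
      distr M node_space (node_vector N C i) = distr M node_space (node_vector N C [])"

definition log_weight :: "(nat list \<Rightarrow> 'w \<Rightarrow> real) \<Rightarrow> nat list \<Rightarrow> 'w \<Rightarrow> ereal" where
  "log_weight C i \<omega> = log_ereal (weight (\<lambda>k. C k \<omega>) i)"

definition intensity ::
  "'w measure \<Rightarrow> (nat list \<Rightarrow> 'w \<Rightarrow> enat) \<Rightarrow> (nat list \<Rightarrow> 'w \<Rightarrow> real) \<Rightarrow> nat \<Rightarrow> ereal measure" where
  "intensity M N C n = measure_of UNIV (sets borel)
     (\<lambda>B. \<integral>\<^sup>+\<omega>. (\<Sum>\<^sub>\<infinity>i\<in>generation (\<lambda>k. N k \<omega>) n. indicator B (log_weight C i \<omega>)) \<partial>M)"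

text \<open>
  The measures live on the extended reals because a node of weight \<open>0\<close> sits at
  \<open>-\<infinity>\<close>, where the density \<open>exp_ereal\<close> vanishes.
\<close>

definition tilted_intensity ::
  "'w measure \<Rightarrow> (nat list \<Rightarrow> 'w \<Rightarrow> enat) \<Rightarrow> (nat list \<Rightarrow> 'w \<Rightarrow> real) \<Rightarrow> real \<Rightarrow> nat \<Rightarrow> ereal measure" where
  "tilted_intensity M N C \<alpha> n = density (intensity M N C n) (\<lambda>t. exp_ereal (ereal \<alpha> * t))"

definition on_reals :: "ereal measure \<Rightarrow> real measure" where
  "on_reals \<nu> = distr (restrict_space \<nu> (range ereal)) borel real_of_ereal"

definition nonarithmetic :: "real measure \<Rightarrow> bool" where
  "nonarithmetic \<nu> \<longleftrightarrow> (\<forall>d>0. emeasure \<nu> (- range (\<lambda>k::int. d * of_int k)) \<noteq> 0)"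

primrec conv_power :: "real measure \<Rightarrow> nat \<Rightarrow> real measure" where
  "conv_power \<nu> 0 = return borel 0"
| "conv_power \<nu> (Suc n) = (\<nu> \<star> conv_power \<nu> n)"

end

theory Submission
  imports Defs
begin

text \<open>
  Everything reduces to integrals of test functions. For a nonnegative Borel function \<open>f\<close> on the
  reals, the integral of \<open>f\<close> against the restriction of \<open>tilted_intensity M N C \<alpha> n\<close> to the reals is
  \<open>E (\<Sum>i\<in>A\<^sub>n. \<Pi>\<^sub>i\<^sup>\<alpha> f (ln \<Pi>\<^sub>i))\<close>,
  because \<open>exp_ereal (\<alpha> V) = \<Pi>\<^sup>\<alpha>\<close> for \<open>V = log_ereal \<Pi>\<close>, also when \<open>\<Pi> = 0\<close>
  (lemmas \<open>nn_integral_tilted_intensity\<close> and \<open>nn_integral_on_reals_tilted_intensity\<close>). The factor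
  \<open>\<Pi>\<^sup>\<alpha>\<close> vanishes on nodes of weight zero, so there is no mass at \<open>-\<infinity>\<close>, and for \<open>n = 1\<close>, \<open>f = 1\<close> the
  formula gives the moment that is assumed to equal one.

  For the convolution identity, split a node of generation \<open>n + 1\<close> into its parent \<open>i\<close> and its rank
  \<open>j\<close>. Its weight is \<open>\<Pi>\<^sub>i C\<^sub>i\<^sub>j\<close>, so the summand factors into \<open>\<Pi>\<^sub>i\<^sup>\<alpha>\<close> and \<open>C\<^sub>i\<^sub>j\<^sup>\<alpha> f (ln \<Pi>\<^sub>i + ln C\<^sub>i\<^sub>j)\<close>.
  Whether \<open>i\<close> is in generation \<open>n\<close>, and its weight, depend only on the vectors at
  nodes of length less than \<open>n\<close>, whereas \<open>N\<^sub>i\<close> and the \<open>C\<^sub>i\<^sub>j\<close> belong to the vector at \<open>i\<close>, which is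
  independent of those and distributed as the vector at the root
  (lemma \<open>nn_integral_earlier_and_current_generation\<close>). Integrating out the vector at \<open>i\<close> first
  therefore replaces the inner sum by \<open>\<integral> f (ln \<Pi>\<^sub>i + u) \<eta>(du)\<close>: passing from generation \<open>n + 1\<close> to \<open>n\<close>
  replaces \<open>f\<close> by \<open>\<lambda>v. \<integral> f (v + u) \<eta>(du)\<close> (lemma \<open>expected_generation_sum_Suc\<close>). Iterating this yields the
  \<open>n\<close>-fold convolution power of \<open>\<eta>\<close>.

  The mean is Fubini's theorem on the product of \<open>M\<close> with counting measure, of which \<open>\<eta>\<close> is a
  weighted image. Finally, the density \<open>C\<^sub>j\<^sup>\<alpha>\<close> is positive where \<open>C\<^sub>j > 0\<close>, so a set that is null for
  \<open>\<eta>\<close> is null for the law of each \<open>log C\<^sub>j\<close> on \<open>{N \<ge> j, C\<^sub>j > 0}\<close>; hence \<open>\<eta>\<close> is nonarithmetic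
  as soon as one of these laws is.
\<close>

section \<open>Unordered sums as integrals against counting measure\<close>

lemma infsum_ennreal_eq_nn_integral:
  fixes g :: "'a \<Rightarrow> ennreal"
  assumes "countable A"
  shows "infsum g A = (\<integral>\<^sup>+i. g i \<partial>count_space A)"
proof (cases "finite A")
  case True
  then show ?thesis by (simp add: nn_integral_count_space_finite)
next
  case False
  note bij = bij_betw_from_nat_into[OF assms False]
  have sup: "infsum h B = (SUP F\<in>{F. finite F \<and> F \<subseteq> B}. sum h F)"
    for h :: "'b \<Rightarrow> ennreal" and B
    by (rule nonneg_infsum_complete) simp
  have "infsum g A = (\<Sum>\<^sub>\<infinity>n. g (from_nat_into A n))"
    by (rule infsum_reindex_bij_betw[OF bij, symmetric])
  also have "\<dots> = (\<Sum>n. g (from_nat_into A n))"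
    unfolding sup
  proof (rule antisym)
    show "(SUP F\<in>{F. finite F \<and> F \<subseteq> UNIV}. \<Sum>n\<in>F. g (from_nat_into A n)) \<le> (\<Sum>n. g (from_nat_into A n))"
      by (auto intro!: SUP_least sum_le_suminf)
    show "(\<Sum>n. g (from_nat_into A n)) \<le> (SUP F\<in>{F. finite F \<and> F \<subseteq> UNIV}. \<Sum>n\<in>F. g (from_nat_into A n))"
      unfolding suminf_eq_SUP by (rule SUP_least, rule SUP_upper2[OF _ order_refl]) auto
  qed
  also have "\<dots> = (\<integral>\<^sup>+i. g i \<partial>count_space A)"
    by (simp add: nn_integral_bij_count_space[symmetric, OF bij] nn_integral_count_space_nat)
  finally show ?thesis .
qed

text \<open>
  A sum over a random subset of \<open>B\<close> becomes an integral over the fixed set \<open>B\<close>, which can be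
  exchanged with the expectation.
\<close>
lemma infsum_ennreal_eq_nn_integral_indicator:
  fixes g :: "'a \<Rightarrow> ennreal"
  assumes "countable B" "A \<subseteq> B"
  shows "infsum g A = (\<integral>\<^sup>+i. indicator A i * g i \<partial>count_space B)"
proof -
  have "infsum g A = infsum (\<lambda>i. indicator A i * g i) B"
    using assms(2) by (intro infsum_cong_neutral) auto
  then show ?thesis by (simp add: infsum_ennreal_eq_nn_integral[OF assms(1)])
qed

lemma infsum_cmult_right_ennreal_countable:
  fixes g :: "'a::countable \<Rightarrow> ennreal"
  shows "(\<Sum>\<^sub>\<infinity>i\<in>A. c * g i) = c * infsum g A"
  by (simp add: infsum_ennreal_eq_nn_integral nn_integral_cmult)

text \<open>
  Tonelli's theorem for counting measure: the terms are nonnegative, so they may be grouped freely.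
\<close>
lemma infsum_Sigma_ennreal_countable:
  fixes g :: "'a::countable \<Rightarrow> 'b::countable \<Rightarrow> ennreal"
  shows "(\<Sum>\<^sub>\<infinity>(i, j)\<in>Sigma A B. g i j) = (\<Sum>\<^sub>\<infinity>i\<in>A. \<Sum>\<^sub>\<infinity>j\<in>B i. g i j)"
proof -
  have "(\<Sum>\<^sub>\<infinity>(i, j)\<in>Sigma A B. g i j) =
      (\<integral>\<^sup>+p. indicator (Sigma A B) p * (case p of (i, j) \<Rightarrow> g i j) \<partial>count_space UNIV)"
    by (rule infsum_ennreal_eq_nn_integral_indicator) auto
  also have "\<dots> = (\<integral>\<^sup>+i. \<integral>\<^sup>+j. indicator A i * (indicator (B i) j * g i j) \<partial>count_space UNIV \<partial>count_space UNIV)"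
    unfolding nn_integral_fst_count_space[symmetric]
    by (auto intro!: nn_integral_cong simp: indicator_def)
  also have "\<dots> = (\<Sum>\<^sub>\<infinity>i\<in>A. \<Sum>\<^sub>\<infinity>j\<in>B i. g i j)"
    by (simp add: infsum_ennreal_eq_nn_integral_indicator[of UNIV] nn_integral_cmult)
  finally show ?thesis .
qed

lemma borel_measurable_nn_integral_count_space [measurable (raw)]:
  fixes f :: "'i \<Rightarrow> 'a \<Rightarrow> ennreal"
  assumes "countable I" and [measurable]: "\<And>i. i \<in> I \<Longrightarrow> f i \<in> borel_measurable M"
  shows "(\<lambda>x. \<integral>\<^sup>+i. f i x \<partial>count_space I) \<in> borel_measurable M"
proof (cases "finite I")
  case True
  then show ?thesis by (simp add: nn_integral_count_space_finite)
next
  case False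
  note bij = bij_betw_from_nat_into[OF assms(1) False]
  have [measurable]: "f (from_nat_into I n) \<in> borel_measurable M" for n
    using False by (intro assms(2) from_nat_into) auto
  show ?thesis
    by (simp add: nn_integral_bij_count_space[symmetric, OF bij] nn_integral_count_space_nat)
qed

text \<open>
  The equation also holds for a divergent family: real families converge unordered only if they
  converge absolutely, and otherwise both sides have the default value \<open>0\<close>.
\<close>
lemma infsum_real_eq_integral_count_space:
  fixes f :: "'a \<Rightarrow> real"
  shows "infsum f A = (\<integral>x. f x \<partial>count_space A)"
proof (cases "f summable_on A")
  case True
  then have "Infinite_Set_Sum.abs_summable_on f A"
    using abs_summable_equivalent summable_on_iff_abs_summable_on_real by blast
  then show ?thesis
    using infsetsum_infsum by (fastforce simp: infsetsum_def)
next
  case False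
  then have "\<not> integrable (count_space A) f"
    using abs_summable_equivalent summable_on_iff_abs_summable_on_real
    unfolding abs_summable_on_def by blast
  with False show ?thesis
    by (simp add: infsum_not_exists not_integrable_integral_eq)
qed

lemma measurable_pair_count_space:
  assumes "countable I" "\<And>i. i \<in> I \<Longrightarrow> f i \<in> M \<rightarrow>\<^sub>M K"
  shows "(\<lambda>p. f (snd p) (fst p)) \<in> (M \<Otimes>\<^sub>M count_space I) \<rightarrow>\<^sub>M K"
proof (rule measurable_compose_countable'[where f="\<lambda>i p. f i (fst p)" and g=snd and I=I])
  show "(\<lambda>p. f i (fst p)) \<in> (M \<Otimes>\<^sub>M count_space I) \<rightarrow>\<^sub>M K" if "i \<in> I" for i
    using assms(2)[OF that] by (rule measurable_compose[OF measurable_fst])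
qed (rule measurable_snd assms(1))+

section \<open>Sums over one realization of the tree\<close>

abbreviation nodes :: "nat list set" where
  "nodes \<equiv> lists {1..}"

definition offspring_sum :: "real \<Rightarrow> (real \<Rightarrow> ennreal) \<Rightarrow> enat \<Rightarrow> (nat \<Rightarrow> real) \<Rightarrow> ennreal" where
  "offspring_sum \<alpha> f n c = (\<Sum>\<^sub>\<infinity>j\<in>children n. ennreal (c j powr \<alpha>) * f (ln (c j)))"

definition generation_sum ::
  "real \<Rightarrow> (real \<Rightarrow> ennreal) \<Rightarrow> (nat list \<Rightarrow> enat) \<Rightarrow> (nat list \<Rightarrow> real) \<Rightarrow> nat \<Rightarrow> ennreal" where
  "generation_sum \<alpha> f N C n =
     (\<Sum>\<^sub>\<infinity>i\<in>generation N n. ennreal (weight C i powr \<alpha>) * f (ln (weight C i)))"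

lemma children_subset: "children n \<subseteq> {1..}"
  by (auto simp: children_def)

lemma generation_subset_nodes: "generation N n \<subseteq> nodes"
proof (induction n)
  case (Suc n)
  then show ?case by (fastforce simp: children_def)
qed simp

lemma length_generation: "i \<in> generation N n \<Longrightarrow> length i = n"
  by (induction n arbitrary: i) auto

text \<open>
  This congruence and the next one say which vectors determine membership in a generation and the
  weight of a node; they give the independence used in the branching step.
\<close>
lemma generation_cong:
  assumes "\<And>k. k \<in> nodes \<Longrightarrow> length k < n \<Longrightarrow> N k = N' k"
  shows "generation N n = generation N' n"
  using assms
proof (induction n)
  case (Suc n)
  then have "generation N n = generation N' n" by simp
  moreover have "N i = N' i" if "i \<in> generation N n" for i
    using that Suc.prems[of i] generation_subset_nodes[of N n] length_generation[of i N n] by auto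
  ultimately show ?case by auto
qed simp

lemma weight_cong:
  assumes "i \<in> nodes" "\<And>k j. k \<in> nodes \<Longrightarrow> 1 \<le> j \<Longrightarrow> length k < length i \<Longrightarrow> C (k @ [j]) = C' (k @ [j])"
  shows "weight C i = weight C' i"
  using assms by (induction i rule: rev_induct) auto

lemma weight_nonneg:
  assumes "i \<in> nodes" "\<And>k j. k \<in> nodes \<Longrightarrow> 1 \<le> j \<Longrightarrow> 0 \<le> C (k @ [j])"
  shows "0 \<le> weight C i"
  using assms by (induction i rule: rev_induct) auto

lemma generation_sum_1:
  "generation_sum \<alpha> f N C 1 = offspring_sum \<alpha> f (N []) (\<lambda>j. C [j])"
proof -
  have "generation N 1 = (\<lambda>j. [j]) ` children (N [])" by auto
  moreover have "weight C [j] = C [j]" for j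
    using weight.simps(2)[of C "[]" j] by simp
  ultimately show ?thesis
    unfolding generation_sum_def offspring_sum_def
    by (simp add: infsum_reindex inj_on_def o_def)
qed

text \<open>
  The branching property along one realization: the last edge on the path to a node of
  generation \<open>n + 1\<close> contributes a factor to the weight and a summand to its logarithm.
\<close>
lemma generation_sum_Suc:
  assumes nonneg: "\<And>k j. k \<in> nodes \<Longrightarrow> 1 \<le> j \<Longrightarrow> 0 \<le> C (k @ [j])"
  shows "generation_sum \<alpha> f N C (Suc n) =
    (\<Sum>\<^sub>\<infinity>i\<in>generation N n. ennreal (weight C i powr \<alpha>) *
       offspring_sum \<alpha> (\<lambda>u. f (ln (weight C i) + u)) (N i) (\<lambda>j. C (i @ [j])))"
proof -
  let ?w = "weight C"
  let ?S = "Sigma (generation N n) (\<lambda>i. children (N i))"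
  have gen: "generation N (Suc n) = (\<lambda>(i, j). i @ [j]) ` ?S"
    by auto
  have inj: "inj_on (\<lambda>(i, j). i @ [j]) ?S"
    by (auto simp: inj_on_def)
  have "generation_sum \<alpha> f N C (Suc n) =
      (\<Sum>\<^sub>\<infinity>(i, j)\<in>?S. ennreal (?w (i @ [j]) powr \<alpha>) * f (ln (?w (i @ [j]))))"
    unfolding generation_sum_def gen infsum_reindex[OF inj] by (simp add: o_def case_prod_unfold)
  also have "\<dots> = (\<Sum>\<^sub>\<infinity>(i, j)\<in>?S. ennreal (?w i powr \<alpha>) *
        (ennreal (C (i @ [j]) powr \<alpha>) * f (ln (?w i) + ln (C (i @ [j])))))"
  proof (rule infsum_cong, clarify)
    fix i j assume "i \<in> generation N n" "j \<in> children (N i)"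
    then have "i \<in> nodes" "1 \<le> j"
      using generation_subset_nodes by (blast, simp add: children_def)
    then have "0 \<le> C (i @ [j])"
      by (rule nonneg)
    moreover have "0 \<le> ?w i"
      using \<open>i \<in> nodes\<close> nonneg by (rule weight_nonneg)
    \<comment> \<open>The logarithm is additive only on positive factors; a vanishing factor kills both sides.\<close>
    ultimately consider "?w i = 0 \<or> C (i @ [j]) = 0" | "0 < ?w i" "0 < C (i @ [j])"
      by linarith
    then show "ennreal (?w (i @ [j]) powr \<alpha>) * f (ln (?w (i @ [j]))) =
        ennreal (?w i powr \<alpha>) * (ennreal (C (i @ [j]) powr \<alpha>) * f (ln (?w i) + ln (C (i @ [j]))))"
    proof cases
      case 2
      then have "ennreal (?w (i @ [j]) powr \<alpha>) = ennreal (?w i powr \<alpha>) * ennreal (C (i @ [j]) powr \<alpha>)"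
        by (simp add: powr_mult ennreal_mult' mult.commute)
      moreover from 2 have "ln (?w (i @ [j])) = ln (?w i) + ln (C (i @ [j]))"
        by (simp add: ln_mult)
      ultimately show ?thesis by (simp only: mult.assoc)
    qed auto
  qed
  also have "\<dots> = (\<Sum>\<^sub>\<infinity>i\<in>generation N n. ennreal (?w i powr \<alpha>) *
       offspring_sum \<alpha> (\<lambda>u. f (ln (?w i) + u)) (N i) (\<lambda>j. C (i @ [j])))"
    unfolding offspring_sum_def infsum_Sigma_ennreal_countable infsum_cmult_right_ennreal_countable ..
  finally show ?thesis .
qed

text \<open>
  The test function may depend on the sample point, because the branching step translates \<open>f\<close> by the
  random position of the parent.
\<close>
lemma measurable_offspring_sum:
  assumes [measurable]: "N \<in> S \<rightarrow>\<^sub>M count_space UNIV"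
    and [measurable]: "\<And>j. 1 \<le> j \<Longrightarrow> (\<lambda>\<omega>. c \<omega> j) \<in> borel_measurable S"
    and [measurable]: "(\<lambda>(\<omega>, u). f \<omega> u) \<in> borel_measurable (S \<Otimes>\<^sub>M borel)"
  shows "(\<lambda>\<omega>. offspring_sum \<alpha> (f \<omega>) (N \<omega>) (c \<omega>)) \<in> borel_measurable S"
  unfolding offspring_sum_def children_def
    infsum_ennreal_eq_nn_integral_indicator[OF countableI_type children_subset[unfolded children_def]] indicator_def
  by measurable

lemma pred_in_generation:
  assumes "\<And>k. k \<in> nodes \<Longrightarrow> length k < n \<Longrightarrow> (\<lambda>\<omega>. N \<omega> k) \<in> S \<rightarrow>\<^sub>M count_space UNIV"
  shows "Measurable.pred S (\<lambda>\<omega>. i \<in> generation (N \<omega>) n)"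
  using assms
proof (induction n arbitrary: i)
  case (Suc n)
  show ?case
  proof (cases "butlast i \<in> nodes \<and> length i = Suc n")
    case True
    then have [measurable]: "(\<lambda>\<omega>. N \<omega> (butlast i)) \<in> S \<rightarrow>\<^sub>M count_space UNIV"
      by (intro Suc.prems) auto
    have [measurable]: "Measurable.pred S (\<lambda>\<omega>. butlast i \<in> generation (N \<omega>) n)"
      by (rule Suc.IH) (auto intro: Suc.prems)
    from True have "i \<in> generation (N \<omega>) (Suc n) \<longleftrightarrow>
        butlast i \<in> generation (N \<omega>) n \<and> 1 \<le> last i \<and> enat (last i) \<le> N \<omega> (butlast i)" for \<omega>
      by (cases i rule: rev_cases) (auto simp: children_def)
    then show ?thesis by simp
  next
    case False
    then have "i \<notin> generation (N \<omega>) (Suc n)" for \<omega>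
      using generation_subset_nodes[of "N \<omega>" n] length_generation[of i "N \<omega>" "Suc n"] by auto
    then show ?thesis by (simp del: generation.simps)
  qed
qed simp

lemma borel_measurable_weight:
  assumes "i \<in> nodes"
    and "\<And>k j. k \<in> nodes \<Longrightarrow> 1 \<le> j \<Longrightarrow> length k < length i \<Longrightarrow> (\<lambda>\<omega>. C \<omega> (k @ [j])) \<in> borel_measurable S"
  shows "(\<lambda>\<omega>. weight (C \<omega>) i) \<in> borel_measurable S"
  using assms by (induction i rule: rev_induct) auto

lemma offspring_sum_cong:
  "(\<And>j. 1 \<le> j \<Longrightarrow> c j = c' j) \<Longrightarrow> offspring_sum \<alpha> f n c = offspring_sum \<alpha> f n c'"
  unfolding offspring_sum_def by (rule infsum_cong) (auto simp: children_def)

section \<open>Measures on the extended reals and on the reals\<close>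

text \<open>
  For \<open>w = 0\<close> both sides vanish: \<open>\<alpha> > 0\<close> keeps the argument at \<open>-\<infinity>\<close>, and \<open>0 powr \<alpha> = 0\<close>.
\<close>
lemma exp_ereal_log_ereal:
  assumes "0 \<le> w" "0 < \<alpha>"
  shows "exp_ereal (ereal \<alpha> * log_ereal w) = ennreal (w powr \<alpha>)"
  using assms by (auto simp: exp_ereal_def log_ereal_def powr_def)

lemma measurable_log_ereal [measurable]: "log_ereal \<in> borel_measurable borel"
  unfolding log_ereal_def[abs_def] by measurable

lemma measurable_exp_ereal [measurable]: "exp_ereal \<in> borel_measurable borel"
  unfolding exp_ereal_def[abs_def] by measurable

lemma range_ereal_borel [measurable]: "range ereal \<in> sets borel"
proof -
  have "range ereal = UNIV - {\<infinity>, -\<infinity>}"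
    by (auto simp: image_iff)
  then show ?thesis by simp
qed

lemma sets_on_reals [simp, measurable_cong]: "sets (on_reals \<nu>) = sets borel"
  by (simp add: on_reals_def)

lemma nn_integral_on_reals:
  assumes [measurable_cong]: "sets \<nu> = sets borel" and [measurable]: "f \<in> borel_measurable borel"
  shows "(\<integral>\<^sup>+x. f x \<partial>on_reals \<nu>) = (\<integral>\<^sup>+t. f (real_of_ereal t) * indicator (range ereal) t \<partial>\<nu>)"
proof -
  have "space \<nu> = UNIV" "range ereal \<in> sets \<nu>"
    using sets_eq_imp_space_eq[OF assms(1)] assms(1) by auto
  moreover have "real_of_ereal \<in> borel_measurable (restrict_space \<nu> (range ereal))"
    by (intro measurable_restrict_space1) measurable
  ultimately show ?thesis
    unfolding on_reals_def by (simp add: nn_integral_distr nn_integral_restrict_space)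
qed

lemma fst_node_space: "fst \<in> node_space \<rightarrow>\<^sub>M count_space UNIV"
  unfolding node_space_def by (rule measurable_fst)

lemma snd_node_space: "1 \<le> j \<Longrightarrow> (\<lambda>x. snd x j) \<in> borel_measurable node_space"
  unfolding node_space_def
  by (intro measurable_compose[OF measurable_snd measurable_component_singleton]) simp

lemma finite_measure_conv_power:
  assumes "finite_measure \<nu>" "sets \<nu> = sets borel"
  shows "finite_measure (conv_power \<nu> n)"
proof (induction n)
  case 0
  have "prob_space (return borel (0::real))" by (rule prob_space_return) simp
  then show ?case by (simp add: prob_space.finite_measure)
next
  case (Suc n)
  have "sets (conv_power \<nu> n) = sets borel" by (cases n) auto
  with Suc show ?case by (simp add: assms convolution_finite)
qed

section \<open>The tilted intensity as an expected weighted sum\<close>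

context weighted_branching_tree
begin

lemma node_vector_measurable [measurable]:
  "i \<in> nodes \<Longrightarrow> node_vector N C i \<in> M \<rightarrow>\<^sub>M node_space"
  using indep by (simp add: indep_vars_def)

lemma N_measurable [measurable]: "i \<in> nodes \<Longrightarrow> N i \<in> M \<rightarrow>\<^sub>M count_space UNIV"
  using measurable_compose[OF node_vector_measurable, of i fst "count_space UNIV"]
  by (simp add: node_space_def node_vector_def)

lemma C_measurable [measurable]:
  assumes "i \<in> nodes" "1 \<le> j"
  shows "C (i @ [j]) \<in> borel_measurable M"
  using measurable_compose[OF node_vector_measurable[OF assms(1)] snd_node_space[OF assms(2)]] assms(2)
  by (simp add: node_vector_def)

lemma root_C_measurable [measurable]: "1 \<le> j \<Longrightarrow> C [j] \<in> borel_measurable M"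
  using C_measurable[of "[]" j] by simp

lemma weight_measurable [measurable]:
  "i \<in> nodes \<Longrightarrow> (\<lambda>\<omega>. weight (\<lambda>k. C k \<omega>) i) \<in> borel_measurable M"
  by (rule borel_measurable_weight) measurable

lemma in_generation_measurable [measurable]:
  "Measurable.pred M (\<lambda>\<omega>. i \<in> generation (\<lambda>k. N k \<omega>) n)"
  by (rule pred_in_generation) measurable

lemma log_weight_measurable [measurable]: "i \<in> nodes \<Longrightarrow> log_weight C i \<in> borel_measurable M"
  unfolding log_weight_def[abs_def] by measurable

lemma weight_nonneg_node: "i \<in> nodes \<Longrightarrow> \<omega> \<in> space M \<Longrightarrow> 0 \<le> weight (\<lambda>k. C k \<omega>) i"
  by (rule weight_nonneg) (auto intro: nonneg)

lemma infsum_generation: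
  "(\<Sum>\<^sub>\<infinity>i\<in>generation N' n. g i) = (\<integral>\<^sup>+i. indicator (generation N' n) i * g i \<partial>count_space nodes)"
  for g :: "nat list \<Rightarrow> ennreal"
  by (rule infsum_ennreal_eq_nn_integral_indicator[OF countableI_type generation_subset_nodes])

text \<open>
  Every node of generation \<open>n\<close> counts with mass one, so the total mass is the expected size of the
  generation and may be infinite. The intensity is an image of
  this measure, which shows that its defining set function is countably additive.
\<close>
definition campbell_measure :: "nat \<Rightarrow> ('w \<times> nat list) measure" where
  "campbell_measure n = density (M \<Otimes>\<^sub>M count_space nodes)
     (\<lambda>p. indicator (generation (\<lambda>k. N k (fst p)) n) (snd p))"

lemma log_weight_pair_measurable:
  "(\<lambda>p. log_weight C (snd p) (fst p)) \<in> borel_measurable (M \<Otimes>\<^sub>M count_space nodes)"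
  by (rule measurable_pair_count_space[OF countableI_type]) measurable

lemma in_generation_pair_measurable:
  "(\<lambda>p. indicator (generation (\<lambda>k. N k (fst p)) n) (snd p) :: ennreal)
    \<in> borel_measurable (M \<Otimes>\<^sub>M count_space nodes)"
  unfolding indicator_def by (rule measurable_pair_count_space[OF countableI_type]) measurable

lemma nn_integral_distr_campbell_measure:
  assumes f: "f \<in> borel_measurable borel"
  shows "(\<integral>\<^sup>+t. f t \<partial>distr (campbell_measure n) borel (\<lambda>p. log_weight C (snd p) (fst p))) =
    (\<integral>\<^sup>+\<omega>. (\<Sum>\<^sub>\<infinity>i\<in>generation (\<lambda>k. N k \<omega>) n. f (log_weight C i \<omega>)) \<partial>M)"
proof -
  interpret count: sigma_finite_measure "count_space nodes"
    by (rule sigma_finite_measure_count_space)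
  note V = log_weight_pair_measurable and G = in_generation_pair_measurable[of n]
  note fV = measurable_compose[OF V f]
  have "(\<integral>\<^sup>+t. f t \<partial>distr (campbell_measure n) borel (\<lambda>p. log_weight C (snd p) (fst p))) =
      (\<integral>\<^sup>+p. f (log_weight C (snd p) (fst p)) \<partial>campbell_measure n)"
    using V f by (intro nn_integral_distr) (simp_all add: campbell_measure_def)
  also have "\<dots> = (\<integral>\<^sup>+p. indicator (generation (\<lambda>k. N k (fst p)) n) (snd p) *
        f (log_weight C (snd p) (fst p)) \<partial>(M \<Otimes>\<^sub>M count_space nodes))"
    unfolding campbell_measure_def by (rule nn_integral_density[OF G fV])
  also have "\<dots> = (\<integral>\<^sup>+\<omega>. \<integral>\<^sup>+i. indicator (generation (\<lambda>k. N k \<omega>) n) i *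
        f (log_weight C i \<omega>) \<partial>count_space nodes \<partial>M)"
    using count.nn_integral_fst[OF borel_measurable_times_ennreal[OF G fV]] by simp
  finally show ?thesis by (simp add: infsum_generation)
qed

lemma intensity_eq_distr:
  "intensity M N C n = distr (campbell_measure n) borel (\<lambda>p. log_weight C (snd p) (fst p))" (is "_ = ?D")
proof -
  have "emeasure ?D B =
      (\<integral>\<^sup>+\<omega>. (\<Sum>\<^sub>\<infinity>i\<in>generation (\<lambda>k. N k \<omega>) n. indicator B (log_weight C i \<omega>)) \<partial>M)"
    if "B \<in> sets borel" for B
    using nn_integral_distr_campbell_measure[of "indicator B" n] that by simp
  then have "intensity M N C n = measure_of UNIV (sets borel) (emeasure ?D)"
    unfolding intensity_def
    by (intro measure_of_eq) (auto simp: sets.sigma_sets_eq[of borel, simplified])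
  also have "\<dots> = ?D"
    using measure_of_of_measure[of ?D] by simp
  finally show ?thesis .
qed

lemma sets_tilted_intensity [simp, measurable_cong]:
  "sets (tilted_intensity M N C \<alpha> n) = sets borel"
  by (simp add: tilted_intensity_def intensity_eq_distr)

text \<open>
  On nodes of positive weight \<open>log_weight\<close> is the real number \<open>ln \<Pi>\<close>; on the others the factor \<open>\<Pi>\<^sup>\<alpha>\<close> is
  zero. Hence only the values of \<open>f\<close> on the reals enter.
\<close>
lemma nn_integral_tilted_intensity:
  assumes "0 < \<alpha>" and [measurable]: "f \<in> borel_measurable borel"
  shows "(\<integral>\<^sup>+t. f t \<partial>tilted_intensity M N C \<alpha> n) =
    (\<integral>\<^sup>+\<omega>. generation_sum \<alpha> (\<lambda>x. f (ereal x)) (\<lambda>k. N k \<omega>) (\<lambda>k. C k \<omega>) n \<partial>M)"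
proof -
  have s: "sets (intensity M N C n) = sets borel"
    by (simp add: intensity_eq_distr)
  have m: "g \<in> borel_measurable (intensity M N C n)" if "g \<in> borel_measurable borel" for g :: "ereal \<Rightarrow> ennreal"
    using that measurable_cong_sets[OF s refl] by blast
  have "(\<integral>\<^sup>+t. f t \<partial>tilted_intensity M N C \<alpha> n) =
      (\<integral>\<^sup>+t. exp_ereal (ereal \<alpha> * t) * f t \<partial>intensity M N C n)"
    unfolding tilted_intensity_def by (rule nn_integral_density) (auto intro!: m)
  also have "\<dots> = (\<integral>\<^sup>+\<omega>. (\<Sum>\<^sub>\<infinity>i\<in>generation (\<lambda>k. N k \<omega>) n.
      exp_ereal (ereal \<alpha> * log_weight C i \<omega>) * f (log_weight C i \<omega>)) \<partial>M)"
    unfolding intensity_eq_distr by (rule nn_integral_distr_campbell_measure) measurable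
  also have "\<dots> = (\<integral>\<^sup>+\<omega>. generation_sum \<alpha> (\<lambda>x. f (ereal x)) (\<lambda>k. N k \<omega>) (\<lambda>k. C k \<omega>) n \<partial>M)"
    unfolding generation_sum_def
  proof (intro nn_integral_cong infsum_cong)
    fix \<omega> i assume \<omega>: "\<omega> \<in> space M" and "i \<in> generation (\<lambda>k. N k \<omega>) n"
    then have "0 \<le> weight (\<lambda>k. C k \<omega>) i"
      using generation_subset_nodes weight_nonneg_node by blast
    then show "exp_ereal (ereal \<alpha> * log_weight C i \<omega>) * f (log_weight C i \<omega>) =
        ennreal (weight (\<lambda>k. C k \<omega>) i powr \<alpha>) * f (ereal (ln (weight (\<lambda>k. C k \<omega>) i)))"
      using exp_ereal_log_ereal[OF _ assms(1)] assms(1) by (auto simp: log_weight_def log_ereal_def)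
  qed
  finally show ?thesis .
qed

lemma nn_integral_on_reals_tilted_intensity:
  assumes "0 < \<alpha>" and [measurable]: "f \<in> borel_measurable borel"
  shows "(\<integral>\<^sup>+x. f x \<partial>on_reals (tilted_intensity M N C \<alpha> n)) =
    (\<integral>\<^sup>+\<omega>. generation_sum \<alpha> f (\<lambda>k. N k \<omega>) (\<lambda>k. C k \<omega>) n \<partial>M)"
  by (simp add: nn_integral_on_reals nn_integral_tilted_intensity[OF assms(1)])

lemma nn_integral_on_reals_tilted_intensity_1:
  assumes "0 < \<alpha>" "f \<in> borel_measurable borel"
  shows "(\<integral>\<^sup>+x. f x \<partial>on_reals (tilted_intensity M N C \<alpha> 1)) =
    (\<integral>\<^sup>+\<omega>. offspring_sum \<alpha> f (N [] \<omega>) (\<lambda>j. C [j] \<omega>) \<partial>M)"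
  using nn_integral_on_reals_tilted_intensity[OF assms, of 1] generation_sum_1 by simp

section \<open>Branching and convolution\<close>

text \<open>
  The vector at a node is independent of the vectors at all shorter nodes jointly, and it may be
  replaced by an independent copy of the vector at the root.
\<close>
lemma nn_integral_earlier_and_current_generation:
  assumes i: "i \<in> nodes"
  defines "A \<equiv> {k \<in> nodes. length k < length i}"
  assumes H: "(\<lambda>(y, x). H y x) \<in> borel_measurable ((\<Pi>\<^sub>M k\<in>A. node_space) \<Otimes>\<^sub>M node_space)"
  shows "(\<integral>\<^sup>+\<omega>. H (\<lambda>k\<in>A. node_vector N C k \<omega>) (node_vector N C i \<omega>) \<partial>M) =
    (\<integral>\<^sup>+\<omega>. \<integral>\<^sup>+\<omega>'. H (\<lambda>k\<in>A. node_vector N C k \<omega>) (node_vector N C [] \<omega>') \<partial>M \<partial>M)"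
proof -
  let ?X = "node_vector N C" and ?T = node_space
  let ?S = "\<Pi>\<^sub>M k\<in>A. node_space" and ?Y = "\<lambda>\<omega>. \<lambda>k\<in>A. node_vector N C k \<omega>"
  let ?S' = "\<Pi>\<^sub>M k\<in>{i}. node_space" and ?Y' = "\<lambda>\<omega>. \<lambda>k\<in>{i}. node_vector N C k \<omega>"
  \<comment> \<open>Binary independence relates two variables of one type, so the vector at \<open>i\<close> is carried as a
    family over \<open>{i}\<close> until the joint law has been factored.\<close>
  have "A \<inter> {i} = {}" "A \<subseteq> nodes" "{i} \<subseteq> nodes"
    using i by (auto simp: A_def)
  then have "indep_var ?S ?Y ?S' ?Y'"
    by (rule indep_var_restrict[OF indep])
  then have Y: "?Y \<in> M \<rightarrow>\<^sub>M ?S" and Y': "?Y' \<in> M \<rightarrow>\<^sub>M ?S'"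
    and joint: "distr M ?S ?Y \<Otimes>\<^sub>M distr M ?S' ?Y' = distr M (?S \<Otimes>\<^sub>M ?S') (\<lambda>\<omega>. (?Y \<omega>, ?Y' \<omega>))"
    unfolding indep_var_distribution_eq by auto
  have X: "?X k \<in> M \<rightarrow>\<^sub>M ?T" if "k \<in> nodes" for k
    using that by (rule node_vector_measurable)
  have HY: "(\<lambda>p. H (fst p) (snd p i)) \<in> borel_measurable (?S \<Otimes>\<^sub>M ?S')"
  proof -
    have "(\<lambda>p. snd p i) \<in> (?S \<Otimes>\<^sub>M ?S') \<rightarrow>\<^sub>M ?T"
      by (intro measurable_compose[OF measurable_snd measurable_component_singleton]) simp
    from measurable_compose[OF measurable_Pair[OF measurable_fst this] H] show ?thesis
      by simp
  qed
  have distr: "(\<integral>\<^sup>+x. f x \<partial>distr M K T) = (\<integral>\<^sup>+\<omega>. f (T \<omega>) \<partial>M)"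
    if "T \<in> M \<rightarrow>\<^sub>M K" "f \<in> borel_measurable K" for f :: "'k \<Rightarrow> ennreal" and K T
    using that by (simp add: nn_integral_distr)
  have Hy: "H y \<in> borel_measurable ?T" if "y \<in> space ?S" for y
    using measurable_compose[OF measurable_Pair1'[OF that] H] by simp
  interpret Y': prob_space "distr M ?S' ?Y'" by (rule prob_space_distr[OF Y'])
  have HY_distr: "(\<lambda>p. H (fst p) (snd p i)) \<in> borel_measurable (L \<Otimes>\<^sub>M distr M ?S' ?Y')"
    if "sets L = sets ?S" for L
    unfolding measurable_cong_sets[OF sets_pair_measure_cong[OF that sets_distr] refl] by (rule HY)
  have "(\<integral>\<^sup>+\<omega>. H (?Y \<omega>) (?X i \<omega>) \<partial>M) =
      (\<integral>\<^sup>+p. H (fst p) (snd p i) \<partial>(distr M ?S ?Y \<Otimes>\<^sub>M distr M ?S' ?Y'))"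
    unfolding joint using distr[OF measurable_Pair[OF Y Y'] HY] by simp
  also have "\<dots> = (\<integral>\<^sup>+y. \<integral>\<^sup>+x. H y (x i) \<partial>distr M ?S' ?Y' \<partial>distr M ?S ?Y)"
    using Y'.nn_integral_fst[OF HY_distr[OF sets_distr], symmetric] by (simp only: fst_conv snd_conv)
  also have "\<dots> = (\<integral>\<^sup>+\<omega>. \<integral>\<^sup>+x. H (?Y \<omega>) (x i) \<partial>distr M ?S' ?Y' \<partial>M)"
    using Y'.borel_measurable_nn_integral_fst[OF HY_distr[OF refl]] by (intro distr[OF Y]) (simp only: fst_conv snd_conv)
  also have "\<dots> = (\<integral>\<^sup>+\<omega>. \<integral>\<^sup>+\<omega>'. H (?Y \<omega>) (?X [] \<omega>') \<partial>M \<partial>M)"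
  proof (rule nn_integral_cong)
    fix \<omega> assume "\<omega> \<in> space M"
    then have y: "?Y \<omega> \<in> space ?S" by (rule measurable_space[OF Y])
    have "(\<integral>\<^sup>+x. H (?Y \<omega>) (x i) \<partial>distr M ?S' ?Y') = (\<integral>\<^sup>+\<omega>'. H (?Y \<omega>) (?X i \<omega>') \<partial>M)"
      using distr[OF Y' measurable_compose[OF measurable_component_singleton[of i "{i}"] Hy[OF y]]]
      by simp
    also have "\<dots> = (\<integral>\<^sup>+x. H (?Y \<omega>) x \<partial>distr M ?T (?X i))"
      by (rule distr[OF X[OF i] Hy[OF y], symmetric])
    also have "\<dots> = (\<integral>\<^sup>+\<omega>'. H (?Y \<omega>) (?X [] \<omega>') \<partial>M)"
      unfolding ident_distr[OF i] by (rule distr[OF X Hy[OF y]]) simp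
    finally show "(\<integral>\<^sup>+x. H (?Y \<omega>) (x i) \<partial>distr M ?S' ?Y') = \<dots>" .
  qed
  finally show ?thesis .
qed

text \<open>
  Membership of \<open>i\<close> in generation \<open>n\<close> and the weight of \<open>i\<close> are functions of the vectors at shorter
  nodes, and the offspring sum is a function of the vector at \<open>i\<close>; so the latter can be integrated
  out separately.
\<close>
lemma nn_integral_offspring_of_node:
  assumes i: "i \<in> nodes" "length i = n" and f [measurable]: "f \<in> borel_measurable borel"
  shows "(\<integral>\<^sup>+\<omega>. indicator (generation (\<lambda>k. N k \<omega>) n) i * (ennreal (weight (\<lambda>k. C k \<omega>) i powr \<alpha>) *
      offspring_sum \<alpha> (\<lambda>u. f (ln (weight (\<lambda>k. C k \<omega>) i) + u)) (N i \<omega>) (\<lambda>j. C (i @ [j]) \<omega>)) \<partial>M) =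
    (\<integral>\<^sup>+\<omega>. indicator (generation (\<lambda>k. N k \<omega>) n) i * (ennreal (weight (\<lambda>k. C k \<omega>) i powr \<alpha>) *
      (\<integral>\<^sup>+\<omega>'. offspring_sum \<alpha> (\<lambda>u. f (ln (weight (\<lambda>k. C k \<omega>) i) + u))
        (N [] \<omega>') (\<lambda>j. C [j] \<omega>') \<partial>M)) \<partial>M)"
proof -
  define A where "A = {k \<in> nodes. length k < n}"
  \<comment> \<open>The weight of the edge from \<open>k\<close> to \<open>k @ [j]\<close> is stored at position \<open>j\<close> of the vector at \<open>k\<close>.\<close>
  define W where "W y = weight (\<lambda>k. snd (y (butlast k)) (last k)) i" for y :: "nat list \<Rightarrow> enat \<times> (nat \<Rightarrow> real)"
  define G :: "(nat list \<Rightarrow> enat \<times> (nat \<Rightarrow> real)) \<Rightarrow> ennreal"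
    where "G y = indicator (generation (\<lambda>k. fst (y k)) n) i" for y
  define F where "F v x = offspring_sum \<alpha> (\<lambda>u. f (v + u)) (fst x) (snd x)" for v and x :: "enat \<times> (nat \<Rightarrow> real)"
  define H where "H y x = G y * (ennreal (W y powr \<alpha>) * F (ln (W y)) x)" for y x
  let ?S = "\<Pi>\<^sub>M k\<in>A. node_space" and ?Y = "\<lambda>\<omega>. \<lambda>k\<in>A. node_vector N C k \<omega>"
  let ?P = "?S \<Otimes>\<^sub>M node_space"
  have comp: "(\<lambda>p. fst p k) \<in> ?P \<rightarrow>\<^sub>M node_space" if "k \<in> nodes" "length k < n" for k
    using that by (intro measurable_compose[OF measurable_fst measurable_component_singleton]) (simp add: A_def)
  have [measurable]: "(\<lambda>p. W (fst p)) \<in> borel_measurable ?P"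
    unfolding W_def
  proof (rule borel_measurable_weight[OF i(1)])
    fix k j assume "k \<in> nodes" "(1::nat) \<le> j" "length k < length i"
    then show "(\<lambda>p. snd (fst p (butlast (k @ [j]))) (last (k @ [j]))) \<in> borel_measurable ?P"
      using measurable_compose[OF comp snd_node_space] i(2) by simp
  qed
  have [measurable]: "Measurable.pred ?P (\<lambda>p. i \<in> generation (\<lambda>k. fst (fst p k)) n)"
    using measurable_compose[OF comp fst_node_space] by (intro pred_in_generation)
  have [measurable]: "(\<lambda>p. G (fst p)) \<in> borel_measurable ?P"
    unfolding G_def indicator_def by measurable
  have [measurable]: "(\<lambda>p. F (ln (W (fst p))) (snd p)) \<in> borel_measurable ?P"
    unfolding F_def
  proof (rule measurable_offspring_sum)
    show "(\<lambda>p. fst (snd p)) \<in> ?P \<rightarrow>\<^sub>M count_space UNIV"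
      by (rule measurable_compose[OF measurable_snd fst_node_space])
    show "(\<lambda>p. snd (snd p) j) \<in> borel_measurable ?P" if "1 \<le> j" for j
      using measurable_compose[OF measurable_snd snd_node_space[OF that]] .
    show "(\<lambda>(p, u). f (ln (W (fst p)) + u)) \<in> borel_measurable (?P \<Otimes>\<^sub>M borel)"
      by measurable
  qed
  have H: "(\<lambda>(y, x). H y x) \<in> borel_measurable ?P"
    unfolding H_def case_prod_unfold by measurable
  have G_Y: "G (?Y \<omega>) = indicator (generation (\<lambda>k. N k \<omega>) n) i" for \<omega>
    unfolding G_def by (subst generation_cong[of n _ "\<lambda>k. N k \<omega>"]) (auto simp: A_def node_vector_def)
  have W_Y: "W (?Y \<omega>) = weight (\<lambda>k. C k \<omega>) i" for \<omega>
    unfolding W_def using i by (intro weight_cong) (auto simp: A_def node_vector_def)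
  have F_X: "F v (node_vector N C k \<omega>) =
      offspring_sum \<alpha> (\<lambda>u. f (v + u)) (N k \<omega>) (\<lambda>j. C (k @ [j]) \<omega>)" for v k \<omega>
    unfolding F_def node_vector_def by (simp, rule offspring_sum_cong) simp
  have F_meas: "(\<lambda>\<omega>. F v (node_vector N C [] \<omega>)) \<in> borel_measurable M" for v
    unfolding F_X
  proof (rule measurable_offspring_sum)
    show "N [] \<in> M \<rightarrow>\<^sub>M count_space UNIV"
      by (rule N_measurable) simp
    show "C ([] @ [j]) \<in> borel_measurable M" if "1 \<le> j" for j
      using that by (intro C_measurable) simp_all
    show "(\<lambda>(\<omega>, u). f (v + u)) \<in> borel_measurable (M \<Otimes>\<^sub>M borel)"
      by measurable
  qed
  have "(\<integral>\<^sup>+\<omega>. H (?Y \<omega>) (node_vector N C i \<omega>) \<partial>M) =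
      (\<integral>\<^sup>+\<omega>. \<integral>\<^sup>+\<omega>'. H (?Y \<omega>) (node_vector N C [] \<omega>') \<partial>M \<partial>M)"
    using nn_integral_earlier_and_current_generation[OF i(1), of H] H unfolding A_def i(2) by simp
  then show ?thesis
    unfolding H_def nn_integral_cmult[OF borel_measurable_times_ennreal[OF borel_measurable_const F_meas]]
      nn_integral_cmult[OF F_meas]
    unfolding G_Y W_Y F_X by simp
qed

text \<open>
  One generation acts on test functions as the translation average \<open>f \<mapsto> g\<close>. Both expectations are
  written as sums over all nodes, so that the terms can be compared node by node.
\<close>
lemma expected_generation_sum_Suc:
  assumes f [measurable]: "f \<in> borel_measurable borel"
    and g [measurable]: "g \<in> borel_measurable borel"
    and g_eq: "\<And>v. g v = (\<integral>\<^sup>+\<omega>. offspring_sum \<alpha> (\<lambda>u. f (v + u)) (N [] \<omega>) (\<lambda>j. C [j] \<omega>) \<partial>M)"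
  shows "(\<integral>\<^sup>+\<omega>. generation_sum \<alpha> f (\<lambda>k. N k \<omega>) (\<lambda>k. C k \<omega>) (Suc n) \<partial>M) =
    (\<integral>\<^sup>+\<omega>. generation_sum \<alpha> g (\<lambda>k. N k \<omega>) (\<lambda>k. C k \<omega>) n \<partial>M)"
proof -
  let ?w = "\<lambda>i \<omega>. weight (\<lambda>k. C k \<omega>) i" and ?gen = "\<lambda>\<omega>. generation (\<lambda>k. N k \<omega>) n"
  let ?off = "\<lambda>i \<omega>. offspring_sum \<alpha> (\<lambda>u. f (ln (?w i \<omega>) + u)) (N i \<omega>) (\<lambda>j. C (i @ [j]) \<omega>)"
  have ind [measurable]: "(\<lambda>\<omega>. indicator (?gen \<omega>) i :: ennreal) \<in> borel_measurable M" for i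
    unfolding indicator_def by measurable
  have off [measurable]: "?off i \<in> borel_measurable M" if [measurable]: "i \<in> nodes" for i
    by (rule measurable_offspring_sum) measurable
  have "(\<integral>\<^sup>+\<omega>. generation_sum \<alpha> f (\<lambda>k. N k \<omega>) (\<lambda>k. C k \<omega>) (Suc n) \<partial>M) =
      (\<integral>\<^sup>+\<omega>. \<integral>\<^sup>+i. indicator (?gen \<omega>) i * (ennreal (?w i \<omega> powr \<alpha>) * ?off i \<omega>) \<partial>count_space nodes \<partial>M)"
  proof (rule nn_integral_cong)
    fix \<omega> assume "\<omega> \<in> space M"
    then have "0 \<le> C (k @ [j]) \<omega>" if "k \<in> nodes" "1 \<le> j" for k j
      using that nonneg by blast
    then show "generation_sum \<alpha> f (\<lambda>k. N k \<omega>) (\<lambda>k. C k \<omega>) (Suc n) =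
        (\<integral>\<^sup>+i. indicator (?gen \<omega>) i * (ennreal (?w i \<omega> powr \<alpha>) * ?off i \<omega>) \<partial>count_space nodes)"
      unfolding infsum_generation[symmetric] by (rule generation_sum_Suc)
  qed
  also have "\<dots> = (\<integral>\<^sup>+i. \<integral>\<^sup>+\<omega>. indicator (?gen \<omega>) i * (ennreal (?w i \<omega> powr \<alpha>) * ?off i \<omega>) \<partial>M \<partial>count_space nodes)"
    by (rule nn_integral_count_space_nn_integral) measurable
  also have "\<dots> = (\<integral>\<^sup>+i. \<integral>\<^sup>+\<omega>. indicator (?gen \<omega>) i * (ennreal (?w i \<omega> powr \<alpha>) * g (ln (?w i \<omega>))) \<partial>M \<partial>count_space nodes)"
  proof (rule nn_integral_cong)
    fix i assume "i \<in> space (count_space nodes)"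
    then have i: "i \<in> nodes" by simp
    show "(\<integral>\<^sup>+\<omega>. indicator (?gen \<omega>) i * (ennreal (?w i \<omega> powr \<alpha>) * ?off i \<omega>) \<partial>M) =
        (\<integral>\<^sup>+\<omega>. indicator (?gen \<omega>) i * (ennreal (?w i \<omega> powr \<alpha>) * g (ln (?w i \<omega>))) \<partial>M)"
    proof (cases "length i = n")
      case True
      then show ?thesis
        unfolding g_eq by (rule nn_integral_offspring_of_node[OF i _ f])
    next
      case False
      then have "i \<notin> ?gen \<omega>" for \<omega> using length_generation by blast
      then show ?thesis by simp
    qed
  qed
  also have "\<dots> = (\<integral>\<^sup>+\<omega>. \<integral>\<^sup>+i. indicator (?gen \<omega>) i * (ennreal (?w i \<omega> powr \<alpha>) * g (ln (?w i \<omega>))) \<partial>count_space nodes \<partial>M)"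
    by (rule nn_integral_count_space_nn_integral[symmetric]) measurable
  also have "\<dots> = (\<integral>\<^sup>+\<omega>. generation_sum \<alpha> g (\<lambda>k. N k \<omega>) (\<lambda>k. C k \<omega>) n \<partial>M)"
    by (simp add: generation_sum_def infsum_generation)
  finally show ?thesis .
qed

text \<open>
  The induction runs over all test functions at once: the step from \<open>n\<close> to \<open>n + 1\<close> applies the
  hypothesis to the averaged function. It starts at the root, which sits at \<open>ln 1 = 0\<close> with weight one.
\<close>
lemma expected_generation_sum_eq_conv_power:
  assumes "0 < \<alpha>" and \<eta>: "\<eta> = on_reals (tilted_intensity M N C \<alpha> 1)" and "finite_measure \<eta>"
    and "f \<in> borel_measurable borel"
  shows "(\<integral>\<^sup>+\<omega>. generation_sum \<alpha> f (\<lambda>k. N k \<omega>) (\<lambda>k. C k \<omega>) n \<partial>M) = (\<integral>\<^sup>+x. f x \<partial>conv_power \<eta> n)"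
  using assms(4)
proof (induction n arbitrary: f)
  case 0
  then show ?case
    by (simp add: generation_sum_def nn_integral_return emeasure_space_1)
next
  case (Suc n)
  note [measurable] = Suc.prems
  have sets_\<eta> [measurable_cong]: "sets \<eta> = sets borel"
    by (simp add: \<eta>)
  interpret \<eta>: finite_measure \<eta> by fact
  have cp [measurable_cong]: "sets (conv_power \<eta> n) = sets borel"
    by (cases n) auto
  have fin: "finite_measure (conv_power \<eta> n)"
    using finite_measure_conv_power[OF assms(3) sets_\<eta>] .
  let ?g = "\<lambda>v. \<integral>\<^sup>+u. f (v + u) \<partial>\<eta>"
  have g: "?g \<in> borel_measurable borel"
    by measurable
  have "?g v = (\<integral>\<^sup>+\<omega>. offspring_sum \<alpha> (\<lambda>u. f (v + u)) (N [] \<omega>) (\<lambda>j. C [j] \<omega>) \<partial>M)" for v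
    unfolding \<eta> by (rule nn_integral_on_reals_tilted_intensity_1[OF assms(1)]) measurable
  then have "(\<integral>\<^sup>+\<omega>. generation_sum \<alpha> f (\<lambda>k. N k \<omega>) (\<lambda>k. C k \<omega>) (Suc n) \<partial>M) =
      (\<integral>\<^sup>+\<omega>. generation_sum \<alpha> ?g (\<lambda>k. N k \<omega>) (\<lambda>k. C k \<omega>) n \<partial>M)"
    by (rule expected_generation_sum_Suc[OF Suc.prems g])
  also have "\<dots> = (\<integral>\<^sup>+v. \<integral>\<^sup>+u. f (v + u) \<partial>\<eta> \<partial>conv_power \<eta> n)"
    by (rule Suc.IH[OF g])
  also have "\<dots> = (\<integral>\<^sup>+x. f x \<partial>(conv_power \<eta> n \<star> \<eta>))"
    by (rule nn_integral_convolution[symmetric]) (auto simp: fin assms(3) cp sets_\<eta>)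
  also have "conv_power \<eta> n \<star> \<eta> = conv_power \<eta> (Suc n)"
    using convolution_commutative[OF fin assms(3)] by (simp add: cp sets_\<eta>)
  finally show ?case .
qed

lemma tilted_intensity_eq_conv_power:
  assumes "0 < \<alpha>" "finite_measure (on_reals (tilted_intensity M N C \<alpha> 1))"
  shows "tilted_intensity M N C \<alpha> n =
    distr (conv_power (on_reals (tilted_intensity M N C \<alpha> 1)) n) borel ereal" (is "_ = distr ?\<mu> _ _")
proof (rule measure_eqI)
  fix B assume "B \<in> sets (tilted_intensity M N C \<alpha> n)"
  then have B [measurable]: "B \<in> sets borel" by simp
  have [measurable_cong]: "sets ?\<mu> = sets borel"
    by (cases n) auto
  have "emeasure (tilted_intensity M N C \<alpha> n) B = (\<integral>\<^sup>+t. indicator B t \<partial>tilted_intensity M N C \<alpha> n)"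
    by simp
  also have "\<dots> = (\<integral>\<^sup>+\<omega>. generation_sum \<alpha> (\<lambda>x. indicator B (ereal x)) (\<lambda>k. N k \<omega>) (\<lambda>k. C k \<omega>) n \<partial>M)"
    by (rule nn_integral_tilted_intensity[OF assms(1)]) measurable
  also have "\<dots> = (\<integral>\<^sup>+x. indicator B (ereal x) \<partial>?\<mu>)"
    by (rule expected_generation_sum_eq_conv_power[OF assms(1) refl assms(2)]) measurable
  also have "\<dots> = (\<integral>\<^sup>+t. indicator B t \<partial>distr ?\<mu> borel ereal)"
    by (rule nn_integral_distr[symmetric]) measurable
  finally show "emeasure (tilted_intensity M N C \<alpha> n) B = emeasure (distr ?\<mu> borel ereal) B"
    by simp
qed simp

section \<open>Mean and lattice structure of the first generation\<close>

text \<open>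
  This representation turns integrals of signed functions against \<open>\<eta>\<close> into integrals over a product
  space, where Fubini's theorem applies.
\<close>
lemma on_reals_tilted_intensity_1_eq_distr:
  assumes "0 < \<alpha>"
  shows "on_reals (tilted_intensity M N C \<alpha> 1) =
    distr (density (M \<Otimes>\<^sub>M count_space {1..})
        (\<lambda>p. ennreal (indicator (children (N [] (fst p))) (snd p) * C [snd p] (fst p) powr \<alpha>)))
      borel (\<lambda>p. ln (C [snd p] (fst p)))" (is "_ = distr (density ?P ?h) _ ?l")
proof (rule measure_eqI)
  interpret count: sigma_finite_measure "count_space {1::nat..}"
    by (rule sigma_finite_measure_count_space)
  have l: "?l \<in> borel_measurable ?P"
    by (rule measurable_pair_count_space[OF countableI_type]) measurable
  have h: "?h \<in> borel_measurable ?P"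
    unfolding indicator_def children_def
    by (rule measurable_pair_count_space[OF countableI_type]) measurable
  fix B assume "B \<in> sets (on_reals (tilted_intensity M N C \<alpha> 1))"
  then have B [measurable]: "B \<in> sets borel" by simp
  have iB: "(indicator B :: real \<Rightarrow> ennreal) \<in> borel_measurable borel"
    by measurable
  have "emeasure (on_reals (tilted_intensity M N C \<alpha> 1)) B =
      (\<integral>\<^sup>+x. indicator B x \<partial>on_reals (tilted_intensity M N C \<alpha> 1))"
    by simp
  also have "\<dots> = (\<integral>\<^sup>+\<omega>. \<integral>\<^sup>+j. ?h (\<omega>, j) * indicator B (?l (\<omega>, j)) \<partial>count_space {1..} \<partial>M)"
    unfolding nn_integral_on_reals_tilted_intensity_1[OF assms iB] offspring_sum_def
      infsum_ennreal_eq_nn_integral_indicator[OF countableI_type children_subset]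
    by (intro nn_integral_cong) (auto simp: indicator_def)
  also have "\<dots> = (\<integral>\<^sup>+p. ?h p * indicator B (?l p) \<partial>?P)"
    by (rule count.nn_integral_fst[OF borel_measurable_times_ennreal[OF h measurable_compose[OF l iB]]])
  also have "\<dots> = (\<integral>\<^sup>+p. indicator B (?l p) \<partial>density ?P ?h)"
    by (rule nn_integral_density[OF h measurable_compose[OF l iB], symmetric])
  also have "\<dots> = (\<integral>\<^sup>+x. indicator B x \<partial>distr (density ?P ?h) borel ?l)"
    using l iB by (intro nn_integral_distr[symmetric]) simp_all
  finally show "emeasure (on_reals (tilted_intensity M N C \<alpha> 1)) B = emeasure (distr (density ?P ?h) borel ?l) B"
    by simp
qed simp

lemma mean_on_reals_tilted_intensity_1:
  assumes "0 < \<alpha>"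
    and fin: "(\<integral>\<^sup>+\<omega>. (\<Sum>\<^sub>\<infinity>j\<in>children (N [] \<omega>). ennreal \<bar>C [j] \<omega> powr \<alpha> * ln (C [j] \<omega>)\<bar>) \<partial>M) < \<infinity>"
  shows "integrable (on_reals (tilted_intensity M N C \<alpha> 1)) (\<lambda>u. u)" (is ?integrable)
    and "(\<integral>u. u \<partial>on_reals (tilted_intensity M N C \<alpha> 1)) =
      (\<integral>\<omega>. (\<Sum>\<^sub>\<infinity>j\<in>children (N [] \<omega>). C [j] \<omega> powr \<alpha> * ln (C [j] \<omega>)) \<partial>M)" (is ?mean)
proof -
  \<comment> \<open>Keeps the index set in the form \<open>{1..}\<close> in which the measurability facts are stated.\<close>
  note One_nat_def [simp del]
  interpret count: sigma_finite_measure "count_space {1::nat..}"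
    by (rule sigma_finite_measure_count_space)
  interpret pair: pair_sigma_finite M "count_space {1::nat..}" ..
  let ?P = "M \<Otimes>\<^sub>M count_space {1::nat..}"
  define h :: "'w \<times> nat \<Rightarrow> real" where "h p = indicator (children (N [] (fst p))) (snd p) * C [snd p] (fst p) powr \<alpha>" for p
  define l where "l p = ln (C [snd p] (fst p))" for p
  have l [measurable]: "l \<in> borel_measurable ?P"
    unfolding l_def by (rule measurable_pair_count_space[OF countableI_type]) measurable
  have h [measurable]: "h \<in> borel_measurable ?P"
    unfolding h_def indicator_def children_def
    by (rule measurable_pair_count_space[OF countableI_type]) measurable
  have h_nonneg: "AE p in ?P. 0 \<le> h p"
    by (simp add: h_def)
  have \<eta>: "on_reals (tilted_intensity M N C \<alpha> 1) = distr (density ?P (\<lambda>p. ennreal (h p))) borel l"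
    unfolding h_def[abs_def] l_def[abs_def] by (rule on_reals_tilted_intensity_1_eq_distr[OF assms(1)])
  have "(\<integral>\<^sup>+p. ennreal (norm (h p * l p)) \<partial>?P) =
      (\<integral>\<^sup>+\<omega>. \<integral>\<^sup>+j. ennreal (norm (h (\<omega>, j) * l (\<omega>, j))) \<partial>count_space {1..} \<partial>M)"
    by (rule count.nn_integral_fst[symmetric]) measurable
  also have "\<dots> = (\<integral>\<^sup>+\<omega>. (\<Sum>\<^sub>\<infinity>j\<in>children (N [] \<omega>). ennreal \<bar>C [j] \<omega> powr \<alpha> * ln (C [j] \<omega>)\<bar>) \<partial>M)"
    unfolding infsum_ennreal_eq_nn_integral_indicator[OF countableI_type children_subset]
    by (intro nn_integral_cong) (auto simp: indicator_def h_def l_def)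
  finally have int: "integrable ?P (\<lambda>p. h p * l p)"
    using fin by (intro integrableI_bounded) simp_all
  show ?integrable
    unfolding \<eta> using int h_nonneg
    by (subst integrable_distr_eq) (simp_all add: integrable_density)
  have "(\<integral>u. u \<partial>on_reals (tilted_intensity M N C \<alpha> 1)) = (\<integral>p. h p * l p \<partial>?P)"
    unfolding \<eta> using h_nonneg by (subst integral_distr) (simp_all add: integral_density)
  also have "\<dots> = (\<integral>\<omega>. \<integral>j. h (\<omega>, j) * l (\<omega>, j) \<partial>count_space {1..} \<partial>M)"
    by (rule pair.integral_fst'[OF int, symmetric])
  also have "\<dots> = (\<integral>\<omega>. (\<Sum>\<^sub>\<infinity>j\<in>children (N [] \<omega>). C [j] \<omega> powr \<alpha> * ln (C [j] \<omega>)) \<partial>M)"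
  proof (rule Bochner_Integration.integral_cong[OF refl])
    fix \<omega>
    show "(\<integral>j. h (\<omega>, j) * l (\<omega>, j) \<partial>count_space {1..}) =
        (\<Sum>\<^sub>\<infinity>j\<in>children (N [] \<omega>). C [j] \<omega> powr \<alpha> * ln (C [j] \<omega>))"
      unfolding infsum_real_eq_integral_count_space[symmetric]
      using children_subset by (intro infsum_cong_neutral) (auto simp: h_def l_def)
  qed
  finally show ?mean .
qed

text \<open>
  The \<open>j\<close>-th term bounds the offspring sum from below and is positive wherever \<open>j \<le> N\<close>, \<open>C\<^sub>j > 0\<close> and
  \<open>ln C\<^sub>j\<close> is off the lattice. If the lattice carried all of \<open>\<eta>\<close>, that event would be null.
\<close>
lemma nonarithmetic_on_reals_tilted_intensity_1:
  assumes "0 < \<alpha>" and j: "1 \<le> j"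
    and nonarith: "nonarithmetic (distr (restrict_space M {\<omega> \<in> space M. enat j \<le> N [] \<omega> \<and> 0 < C [j] \<omega>})
        borel (\<lambda>\<omega>. ln (C [j] \<omega>)))"
  shows "nonarithmetic (on_reals (tilted_intensity M N C \<alpha> 1))"
  unfolding nonarithmetic_def
proof (intro allI impI notI)
  fix d :: real assume "0 < d"
  define B where "B = - range (\<lambda>k::int. d * of_int k)"
  let ?E = "{\<omega> \<in> space M. enat j \<le> N [] \<omega> \<and> 0 < C [j] \<omega>}"
  let ?bad = "\<lambda>\<omega>. enat j \<le> N [] \<omega> \<and> 0 < C [j] \<omega> \<and> ln (C [j] \<omega>) \<in> B"
  let ?S = "\<lambda>\<omega>. offspring_sum \<alpha> (indicator B) (N [] \<omega>) (\<lambda>j. C [j] \<omega>)"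
  note [measurable] = root_C_measurable[OF j]
  have "range (\<lambda>k::int. d * of_int k) \<in> sets borel"
    by (rule sets.countable) auto
  then have B [measurable]: "B \<in> sets borel"
    by (simp add: B_def Compl_eq_Diff_UNIV sets.Diff)
  have S: "?S \<in> borel_measurable M"
    by (rule measurable_offspring_sum) measurable
  have E: "?E \<in> sets M" by measurable
  assume "emeasure (on_reals (tilted_intensity M N C \<alpha> 1)) (- range (\<lambda>k::int. d * of_int k)) = 0"
  then have "(\<integral>\<^sup>+x. indicator B x \<partial>on_reals (tilted_intensity M N C \<alpha> 1)) = 0"
    by (simp add: B_def[symmetric])
  then have "(\<integral>\<^sup>+\<omega>. ?S \<omega> \<partial>M) = 0"
    by (subst (asm) nn_integral_on_reals_tilted_intensity_1[OF assms(1)]) measurable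
  then have "AE \<omega> in M. ?S \<omega> = 0"
    using nn_integral_0_iff_AE[OF S] by simp
  then have "AE \<omega> in M. \<not> ?bad \<omega>"
  proof (rule AE_mp, intro AE_I2 impI notI)
    fix \<omega> assume S0: "?S \<omega> = 0" and \<omega>: "?bad \<omega>"
    let ?t = "\<lambda>j. ennreal (C [j] \<omega> powr \<alpha>) * indicator B (ln (C [j] \<omega>))"
    from \<omega> j have "j \<in> children (N [] \<omega>)"
      by (simp add: children_def)
    then have "?t j \<le> (\<integral>\<^sup>+j. ?t j \<partial>count_space (children (N [] \<omega>)))"
      by (rule nn_integral_ge_point)
    also have "\<dots> = 0"
      using S0 by (simp add: offspring_sum_def infsum_ennreal_eq_nn_integral)
    finally show False using \<omega> by simp
  qed
  then have null: "emeasure M {\<omega> \<in> space M. ?bad \<omega>} = 0"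
    by (rule emeasure_eq_0_AE)
  have "emeasure (distr (restrict_space M ?E) borel (\<lambda>\<omega>. ln (C [j] \<omega>))) B =
      emeasure (restrict_space M ?E) ((\<lambda>\<omega>. ln (C [j] \<omega>)) -` B \<inter> space (restrict_space M ?E))"
    by (intro emeasure_distr measurable_restrict_space1) measurable
  also have "\<dots> = emeasure M {\<omega> \<in> space M. ?bad \<omega>}"
    using E by (subst emeasure_restrict_space)
      (auto simp: space_restrict_space intro!: arg_cong[where f="emeasure M"])
  finally have "emeasure (distr (restrict_space M ?E) borel (\<lambda>\<omega>. ln (C [j] \<omega>))) B = 0"
    using null by simp
  with nonarith \<open>0 < d\<close> show False
    by (auto simp: nonarithmetic_def B_def)
qed

end

section \<open>The tilted intensities as convolution powers\<close>

theorem lemma3p1: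
  fixes M :: "'w measure"
    and N :: "nat list \<Rightarrow> 'w \<Rightarrow> enat"
    and C :: "nat list \<Rightarrow> 'w \<Rightarrow> real"
    and \<alpha> :: real
    and \<eta> :: "ereal measure"
  assumes tree: "weighted_branching_tree M N C"
    and \<alpha>_pos: "\<alpha> > 0"
    and \<eta>_eq: "\<eta> = tilted_intensity M N C \<alpha> 1"
    and nonarith: "\<exists>j\<ge>1.
      measure M {\<omega> \<in> space M. enat j \<le> N [] \<omega> \<and> 0 < C [j] \<omega>} > 0 \<and>
      nonarithmetic (distr (restrict_space M {\<omega> \<in> space M. enat j \<le> N [] \<omega> \<and> 0 < C [j] \<omega>})
        borel (\<lambda>\<omega>. ln (C [j] \<omega>)))"
    and log_moment_exists:
      "(\<integral>\<^sup>+\<omega>. (\<Sum>\<^sub>\<infinity>i\<in>children (N [] \<omega>). ennreal \<bar>C [i] \<omega> powr \<alpha> * ln (C [i] \<omega>)\<bar>) \<partial>M) < \<infinity>"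
    and log_moment_pos:
      "0 < (\<integral>\<omega>. (\<Sum>\<^sub>\<infinity>i\<in>children (N [] \<omega>). C [i] \<omega> powr \<alpha> * ln (C [i] \<omega>)) \<partial>M)"
    and moment_one:
      "(\<integral>\<^sup>+\<omega>. (\<Sum>\<^sub>\<infinity>i\<in>children (N [] \<omega>). ennreal (C [i] \<omega> powr \<alpha>)) \<partial>M) = 1"
  shows "prob_space (on_reals \<eta>) \<and>
    nonarithmetic (on_reals \<eta>) \<and>
    emeasure \<eta> {-\<infinity>} = 0 \<and>
    emeasure \<eta> {\<infinity>} = 0 \<and>
    integrable (on_reals \<eta>) (\<lambda>u. u) \<and>
    (\<integral>u. u \<partial>on_reals \<eta>) =
      (\<integral>\<omega>. (\<Sum>\<^sub>\<infinity>j\<in>children (N [] \<omega>). C [j] \<omega> powr \<alpha> * ln (C [j] \<omega>)) \<partial>M) \<and>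
    (\<forall>n\<ge>1. tilted_intensity M N C \<alpha> n = distr (conv_power (on_reals \<eta>) n) borel ereal)"
proof -
  interpret weighted_branching_tree M N C by (rule tree)
  note \<eta>_nn = nn_integral_tilted_intensity[OF \<alpha>_pos, of _ 1, folded \<eta>_eq]
  have one: "emeasure (on_reals \<eta>) (space (on_reals \<eta>)) = 1"
    using nn_integral_on_reals_tilted_intensity_1[OF \<alpha>_pos, of "\<lambda>_. 1"] moment_one
    by (simp add: \<eta>_eq offspring_sum_def)
  then have prob: "prob_space (on_reals \<eta>)"
    by (rule prob_spaceI)
  then have fin: "finite_measure (on_reals \<eta>)"
    by (rule prob_space.finite_measure)
  have inf: "emeasure \<eta> {x} = 0" if "\<bar>x\<bar> = \<infinity>" for x
  proof -
    have "emeasure \<eta> {x} = (\<integral>\<^sup>+t. indicator {x} t \<partial>\<eta>)"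
      by (simp add: \<eta>_eq)
    also have "\<dots> = 0"
      using that by (subst \<eta>_nn) (auto simp: generation_sum_def indicator_def)
    finally show ?thesis .
  qed
  from nonarith obtain j where "1 \<le> j"
    and "nonarithmetic (distr (restrict_space M {\<omega> \<in> space M. enat j \<le> N [] \<omega> \<and> 0 < C [j] \<omega>})
        borel (\<lambda>\<omega>. ln (C [j] \<omega>)))"
    by blast
  then have "nonarithmetic (on_reals \<eta>)"
    unfolding \<eta>_eq by (rule nonarithmetic_on_reals_tilted_intensity_1[OF \<alpha>_pos])
  moreover have "tilted_intensity M N C \<alpha> n = distr (conv_power (on_reals \<eta>) n) borel ereal" for n
    unfolding \<eta>_eq by (rule tilted_intensity_eq_conv_power[OF \<alpha>_pos fin[unfolded \<eta>_eq]])
  ultimately show ?thesis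
    using prob inf[of "-\<infinity>"] inf[of \<infinity>] mean_on_reals_tilted_intensity_1[OF \<alpha>_pos log_moment_exists, folded \<eta>_eq] by simp
qed

end
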